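(* Let $G$ be a finite simple connected graph with at least one edge, with maximum degree $\Delta$ and minimum degree $\delta$. If $G\ncong K_2$, then $$\max\{4(\delta-1)^{2},1\}\cdot ID(\mathcal{L}(G))\leq SDD(\mathcal{L}(G))\leq 4(\Delta-1)^{2}\cdot ID(\mathcal{L}(G)).$$ Equality holds on the left if and only if $G$ is regular or $G\cong S_3$, and equality holds on the right if and only if $G$ is regular.
   Context: For a finite simple graph $H$ with vertex set $V_H$ and edge set $E_H$, $d_u$ denotes the degree of vertex $u$ in $H$; the symmetric division deg index is $SDD(H)=\sum_{uv\in E_H}\left(\frac{d_u}{d_v}+\frac{d_v}{d_u}\right)$ and the inverse degree index is $ID(H)=\sum_{u\in V_H}\frac{1}{d_u}$. The line graph $\mathcal{L}(G)$ has vertex set $E_G$, two vertices being adjacent when the corresponding edges of $G$ share a common endpoint. $S_3$ is the star on $3$ vertices (equal to the path on $3$ vertices). *)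

theory Defs
  imports Complex_Main
begin

record 'a ugraph =
  verts :: "'a set"
  edges :: "'a set set"

text \<open>Edges are two-element sets, so loops and parallel edges are excluded.\<close>

definition simple_graph :: "'a ugraph \<Rightarrow> bool" where
  "simple_graph G \<longleftrightarrow>
     finite (verts G) \<and> (\<forall>e\<in>edges G. e \<subseteq> verts G \<and> card e = 2)"

definition connected_graph :: "'a ugraph \<Rightarrow> bool" where
  "connected_graph G \<longleftrightarrow>
     verts G \<noteq> {} \<and>
     (\<forall>u\<in>verts G. \<forall>v\<in>verts G. (u, v) \<in> {(x, y). {x, y} \<in> edges G}\<^sup>*)"

definition graph_iso :: "'a ugraph \<Rightarrow> 'b ugraph \<Rightarrow> bool" where
  "graph_iso G H \<longleftrightarrow>
     (\<exists>f. bij_betw f (verts G) (verts H) \<and>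
          (\<forall>u\<in>verts G. \<forall>v\<in>verts G. {u, v} \<in> edges G \<longleftrightarrow> {f u, f v} \<in> edges H))"

definition complete_graph :: "nat \<Rightarrow> nat ugraph" where
  "complete_graph n =
     \<lparr>verts = {..<n}, edges = {{i, j} | i j. i < n \<and> j < n \<and> i \<noteq> j}\<rparr>"

text \<open>The index \<open>n\<close> counts all vertices, the centre \<open>0\<close> included.\<close>

definition star_graph :: "nat \<Rightarrow> nat ugraph" where
  "star_graph n = \<lparr>verts = {..<n}, edges = {{0, i} | i. 0 < i \<and> i < n}\<rparr>"

definition vdegree :: "'a ugraph \<Rightarrow> 'a \<Rightarrow> nat" where
  "vdegree G v = card {e \<in> edges G. v \<in> e}"

definition max_degree :: "'a ugraph \<Rightarrow> nat" where
  "max_degree G = Max (vdegree G ` verts G)"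

definition min_degree :: "'a ugraph \<Rightarrow> nat" where
  "min_degree G = Min (vdegree G ` verts G)"

definition regular_graph :: "'a ugraph \<Rightarrow> bool" where
  "regular_graph G \<longleftrightarrow> (\<exists>k. \<forall>v\<in>verts G. vdegree G v = k)"

definition line_graph :: "'a ugraph \<Rightarrow> 'a set ugraph" where
  "line_graph G =
     \<lparr>verts = edges G,
      edges = {{e, f} | e f. e \<in> edges G \<and> f \<in> edges G \<and> e \<noteq> f \<and> e \<inter> f \<noteq> {}}\<rparr>"

text \<open>
  For an edge \<open>e = {u, v}\<close>, the inner double sum ranges over the two orderings of its
  endpoints and equals \<open>d\<^sub>u / d\<^sub>v + d\<^sub>v / d\<^sub>u\<close>; see \<open>SDD_summand\<close>.
\<close>

definition SDD :: "'a ugraph \<Rightarrow> real" where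
  "SDD H = (\<Sum>e\<in>edges H. \<Sum>u\<in>e. \<Sum>v\<in>e - {u}. real (vdegree H u) / real (vdegree H v))"

lemma SDD_summand:
  assumes "u \<noteq> v"
  shows "(\<Sum>x\<in>{u, v}. \<Sum>y\<in>{u, v} - {x}. real (vdegree H x) / real (vdegree H y)) =
    real (vdegree H u) / real (vdegree H v) + real (vdegree H v) / real (vdegree H u)"
proof -
  have "{u, v} - {u} = {v}" "{u, v} - {v} = {u}"
    using assms by auto
  then show ?thesis
    using assms by simp
qed

definition ID :: "'a ugraph \<Rightarrow> real" where
  "ID H = (\<Sum>u\<in>verts H. 1 / real (vdegree H u))"

lemma simple_graph_line_graph:
  assumes "simple_graph G"
  shows "simple_graph (line_graph G)"
proof -
  have "edges G \<subseteq> Pow (verts G)"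
    using assms by (auto simp: simple_graph_def)
  then have "finite (edges G)"
    using assms by (auto simp: simple_graph_def intro: finite_subset)
  then show ?thesis
    by (auto simp: simple_graph_def line_graph_def card_insert_if)
qed

end

theory Submission imports Defs begin

text \<open>
  Grouping the summands of \<open>SDD H\<close> by the vertex in the denominator gives
  \<open>SDD H = (\<Sum>v. S v / d v)\<close>, where \<open>S v\<close> is the sum of the degrees of the neighbours of \<open>v\<close>.
  If all degrees lie in \<open>[m, M]\<close> then \<open>m\<^sup>2 \<le> m * d v \<le> S v \<le> M * d v \<le> M\<^sup>2\<close>, which bounds \<open>SDD H\<close> by
  multiples of \<open>ID H\<close>, with equality only if all degrees equal \<open>m\<close> or \<open>M\<close> respectively.
  In the line graph an edge \<open>uv\<close> has degree \<open>d u + d v - 2\<close>, which is at least \<open>1\<close> by connectedness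
  unless the graph is \<open>K\<^sub>2\<close>. The exceptional case on the left arises from \<open>\<delta> = 1\<close>: then every edge
  joins a vertex of degree 1 to one of degree 2.
\<close>

section \<open>Bounds in terms of extremal degrees\<close>

lemma simple_graph_finite_edges:
  assumes "simple_graph H"
  shows "finite (edges H)"
proof -
  have "edges H \<subseteq> Pow (verts H)"
    using assms by (auto simp: simple_graph_def)
  then show ?thesis
    using assms by (auto simp: simple_graph_def intro: finite_subset)
qed

lemma simple_graph_edgeE:
  assumes "simple_graph H" "e \<in> edges H" "u \<in> e"
  obtains v where "e = {u, v}" "u \<noteq> v" "u \<in> verts H" "v \<in> verts H"
proof -
  have "card e = 2" "e \<subseteq> verts H"
    using assms by (auto simp: simple_graph_def)
  then obtain a b where "e = {a, b}" "a \<noteq> b"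
    by (meson card_2_iff)
  with \<open>u \<in> e\<close> \<open>e \<subseteq> verts H\<close> that show ?thesis
    by auto
qed

text \<open>In a simple graph \<open>e - {v}\<close> is a singleton, so the inner sum is the degree
  of the other endpoint. The nested form is what exchanging the sums in \<open>SDD\<close>
  produces.\<close>

definition neighbour_degree_sum :: "'a ugraph \<Rightarrow> 'a \<Rightarrow> real" where
  "neighbour_degree_sum H v = (\<Sum>e | e \<in> edges H \<and> v \<in> e. \<Sum>u\<in>e - {v}. real (vdegree H u))"

text \<open>Double counting of the incident pairs of a vertex and an edge: the sum over edges is
  exchanged with the sum over their endpoints, and the common denominator is then pulled
  out.\<close>

lemma SDD_eq_sum_verts:
  assumes "simple_graph H"
  shows "SDD H = (\<Sum>v\<in>verts H. neighbour_degree_sum H v / real (vdegree H v))"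
proof -
  let ?d = "\<lambda>v. real (vdegree H v)"
  have fin: "finite (edges H)" "finite (verts H)"
    using assms by (auto simp: simple_graph_finite_edges simple_graph_def)
  \<comment> \<open>For \<open>e = {a, b}\<close> both sides consist of the same two quotients.
    Renaming moves the denominator to the outer sum, and the filter over \<open>verts H\<close>
    prepares the exchange of sums.\<close>
  have "(\<Sum>u\<in>e. \<Sum>v\<in>e - {u}. ?d u / ?d v) = (\<Sum>v | v \<in> verts H \<and> v \<in> e. \<Sum>u\<in>e - {v}. ?d u / ?d v)"
    if "e \<in> edges H" for e
  proof -
    have "card e = 2" and sub: "e \<subseteq> verts H"
      using assms that by (auto simp: simple_graph_def)
    then obtain a b where e: "e = {a, b}" and "a \<noteq> b"
      by (meson card_2_iff)
    then have "{a, b} - {a} = {b}" "{a, b} - {b} = {a}"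
      by auto
    moreover have "{v. v \<in> verts H \<and> v \<in> e} = {a, b}"
      using sub e by auto
    ultimately show ?thesis
      using \<open>a \<noteq> b\<close> by (simp add: e)
  qed
  then have "SDD H = (\<Sum>e\<in>edges H. \<Sum>v | v \<in> verts H \<and> v \<in> e. \<Sum>u\<in>e - {v}. ?d u / ?d v)"
    by (simp add: SDD_def)
  also have "\<dots> = (\<Sum>v\<in>verts H. \<Sum>e | e \<in> edges H \<and> v \<in> e. \<Sum>u\<in>e - {v}. ?d u / ?d v)"
    by (rule sum.swap_restrict) (use fin in auto)
  finally show ?thesis
    by (simp add: neighbour_degree_sum_def sum_divide_distrib)
qed

text \<open>Each of the \<open>vdegree H v\<close> edges at \<open>v\<close> contributes the degree
  of one neighbour, and this is at least \<open>m\<close>.\<close>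

lemma neighbour_degree_sum_ge:
  assumes "simple_graph H" and m: "\<And>u. u \<in> verts H \<Longrightarrow> m \<le> real (vdegree H u)"
  shows "m * real (vdegree H v) \<le> neighbour_degree_sum H v"
proof -
  have "m \<le> (\<Sum>u\<in>e - {v}. real (vdegree H u))" if e: "e \<in> edges H" "v \<in> e" for e
  proof -
    obtain w where w: "e = {v, w}" "v \<noteq> w" "w \<in> verts H"
      using simple_graph_edgeE[OF assms(1) e] by metis
    then have "e - {v} = {w}"
      by auto
    then show ?thesis
      using m w by simp
  qed
  then show ?thesis
    unfolding neighbour_degree_sum_def vdegree_def[of H v]
    by (subst mult.commute) (rule sum_bounded_below, auto)
qed

lemma neighbour_degree_sum_le:
  assumes "simple_graph H" and M: "\<And>u. u \<in> verts H \<Longrightarrow> real (vdegree H u) \<le> M"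
  shows "neighbour_degree_sum H v \<le> M * real (vdegree H v)"
proof -
  have "(\<Sum>u\<in>e - {v}. real (vdegree H u)) \<le> M" if e: "e \<in> edges H" "v \<in> e" for e
  proof -
    obtain w where w: "e = {v, w}" "v \<noteq> w" "w \<in> verts H"
      using simple_graph_edgeE[OF assms(1) e] by metis
    then have "e - {v} = {w}"
      by auto
    then show ?thesis
      using M w by simp
  qed
  then show ?thesis
    unfolding neighbour_degree_sum_def vdegree_def[of H v]
    by (subst mult.commute) (rule sum_bounded_above, auto)
qed

text \<open>The differences \<open>g x - f x\<close> are nonnegative, so they sum to zero only if
  each of them vanishes. This carries the equality cases of the index bounds down to single
  vertices.\<close>

lemma sum_le_and_eq_iff:
  fixes f g :: "'a \<Rightarrow> real"
  assumes "finite A" "\<And>x. x \<in> A \<Longrightarrow> f x \<le> g x"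
  shows "sum f A \<le> sum g A" "sum f A = sum g A \<longleftrightarrow> (\<forall>x\<in>A. f x = g x)"
proof -
  show "sum f A \<le> sum g A"
    using assms by (simp add: sum_mono)
  have "sum g A - sum f A = 0 \<longleftrightarrow> (\<forall>x\<in>A. g x - f x = 0)"
    unfolding sum_subtractf[symmetric] using assms by (intro sum_nonneg_eq_0_iff) auto
  then show "sum f A = sum g A \<longleftrightarrow> (\<forall>x\<in>A. f x = g x)"
    unfolding right_minus_eq by metis
qed

text \<open>At each vertex \<open>v\<close> the chain \<open>m * m \<le> m * d v \<le> S v\<close>
  holds, and dividing by \<open>d v\<close> compares the two sums term by term. Equality collapses
  the whole chain, and its first link then gives \<open>d v = m\<close>.\<close>

lemma SDD_ge_ID:
  assumes H: "simple_graph H" and "0 < m" and m: "\<And>u. u \<in> verts H \<Longrightarrow> m \<le> real (vdegree H u)"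
  shows "m\<^sup>2 * ID H \<le> SDD H"
    and "m\<^sup>2 * ID H = SDD H \<longleftrightarrow> (\<forall>u\<in>verts H. real (vdegree H u) = m)"
proof -
  let ?d = "\<lambda>v. real (vdegree H v)" and ?S = "neighbour_degree_sum H"
  have fin: "finite (verts H)"
    using H by (simp add: simple_graph_def)
  have pos: "0 < ?d v" if "v \<in> verts H" for v
    using m[OF that] \<open>0 < m\<close> by linarith
  have S: "m * ?d v \<le> ?S v" for v
    using H m by (rule neighbour_degree_sum_ge)
  have sq: "m\<^sup>2 \<le> m * ?d v" if "v \<in> verts H" for v
    using m[OF that] \<open>0 < m\<close> by (simp add: power2_eq_square)
  have le: "m\<^sup>2 / ?d v \<le> ?S v / ?d v" if "v \<in> verts H" for v
    using S[of v] sq[OF that] by (simp add: divide_right_mono)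
  have ID: "m\<^sup>2 * ID H = (\<Sum>v\<in>verts H. m\<^sup>2 / ?d v)"
    by (simp add: ID_def sum_distrib_left)
  show "m\<^sup>2 * ID H \<le> SDD H"
    unfolding ID SDD_eq_sum_verts[OF H] using fin le by (rule sum_le_and_eq_iff)
  have "m\<^sup>2 * ID H = SDD H \<longleftrightarrow> (\<forall>v\<in>verts H. m\<^sup>2 / ?d v = ?S v / ?d v)"
    unfolding ID SDD_eq_sum_verts[OF H] using fin le by (rule sum_le_and_eq_iff)
  also have "\<dots> \<longleftrightarrow> (\<forall>v\<in>verts H. ?S v = m\<^sup>2)"
    using pos by (intro ball_cong refl) force
  also have "\<dots> \<longleftrightarrow> (\<forall>v\<in>verts H. ?d v = m)"
  proof
    assume eq: "\<forall>v\<in>verts H. ?S v = m\<^sup>2"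
    show "\<forall>v\<in>verts H. ?d v = m"
    proof
      fix v assume v: "v \<in> verts H"
      have "m * ?d v = m\<^sup>2"
        by (rule antisym) (use eq v S[of v] sq[OF v] in auto)
      then show "?d v = m"
        using \<open>0 < m\<close> by (simp add: power2_eq_square)
    qed
  next
    assume eq: "\<forall>v\<in>verts H. ?d v = m"
    show "\<forall>v\<in>verts H. ?S v = m\<^sup>2"
    proof
      fix v assume "v \<in> verts H"
      \<comment> \<open>All degrees equal \<open>m\<close> here, so the opposite estimate applies
        with the same constant and pins down \<open>S v\<close>.\<close>
      moreover have "?S v \<le> m * ?d v"
        by (rule neighbour_degree_sum_le[OF H]) (use eq in auto)
      ultimately show "?S v = m\<^sup>2"
        using S[of v] eq by (simp add: power2_eq_square)
    qed
  qed
  finally show "m\<^sup>2 * ID H = SDD H \<longleftrightarrow> (\<forall>u\<in>verts H. ?d u = m)" .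
qed

text \<open>Mirror image of the lower bound, with the chain
  \<open>S v \<le> M * d v \<le> M * M\<close>. Positivity of the degrees is a separate assumption
  because an upper bound does not provide it: as division by zero yields 0, an isolated vertex would
  contribute 0 to both sides and so spoil the equality case.\<close>

lemma SDD_le_ID:
  assumes H: "simple_graph H" and pos: "\<And>u. u \<in> verts H \<Longrightarrow> 0 < vdegree H u"
    and "0 < M" and M: "\<And>u. u \<in> verts H \<Longrightarrow> real (vdegree H u) \<le> M"
  shows "SDD H \<le> M\<^sup>2 * ID H"
    and "SDD H = M\<^sup>2 * ID H \<longleftrightarrow> (\<forall>u\<in>verts H. real (vdegree H u) = M)"
proof -
  let ?d = "\<lambda>v. real (vdegree H v)" and ?S = "neighbour_degree_sum H"
  have fin: "finite (verts H)"
    using H by (simp add: simple_graph_def)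
  have S: "?S v \<le> M * ?d v" for v
    using H M by (rule neighbour_degree_sum_le)
  have sq: "M * ?d v \<le> M\<^sup>2" if "v \<in> verts H" for v
    using M[OF that] \<open>0 < M\<close> by (simp add: power2_eq_square)
  have le: "?S v / ?d v \<le> M\<^sup>2 / ?d v" if "v \<in> verts H" for v
    using S[of v] sq[OF that] by (simp add: divide_right_mono)
  have ID: "M\<^sup>2 * ID H = (\<Sum>v\<in>verts H. M\<^sup>2 / ?d v)"
    by (simp add: ID_def sum_distrib_left)
  show "SDD H \<le> M\<^sup>2 * ID H"
    unfolding ID SDD_eq_sum_verts[OF H] using fin le by (rule sum_le_and_eq_iff)
  have "SDD H = M\<^sup>2 * ID H \<longleftrightarrow> (\<forall>v\<in>verts H. ?S v / ?d v = M\<^sup>2 / ?d v)"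
    unfolding ID SDD_eq_sum_verts[OF H] using fin le by (rule sum_le_and_eq_iff)
  also have "\<dots> \<longleftrightarrow> (\<forall>v\<in>verts H. ?S v = M\<^sup>2)"
    using pos by (intro ball_cong refl) force
  also have "\<dots> \<longleftrightarrow> (\<forall>v\<in>verts H. ?d v = M)"
  proof
    assume eq: "\<forall>v\<in>verts H. ?S v = M\<^sup>2"
    show "\<forall>v\<in>verts H. ?d v = M"
    proof
      fix v assume v: "v \<in> verts H"
      have "M * ?d v = M\<^sup>2"
        by (rule antisym) (use eq v S[of v] sq[OF v] in auto)
      then show "?d v = M"
        using \<open>0 < M\<close> by (simp add: power2_eq_square)
    qed
  next
    assume eq: "\<forall>v\<in>verts H. ?d v = M"
    show "\<forall>v\<in>verts H. ?S v = M\<^sup>2"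
    proof
      fix v assume "v \<in> verts H"
      moreover have "M * ?d v \<le> ?S v"
        by (rule neighbour_degree_sum_ge[OF H]) (use eq in auto)
      ultimately show "?S v = M\<^sup>2"
        using S[of v] eq by (simp add: power2_eq_square)
    qed
  qed
  finally show "SDD H = M\<^sup>2 * ID H \<longleftrightarrow> (\<forall>u\<in>verts H. ?d u = M)" .
qed

section \<open>Degrees in the line graph\<close>

text \<open>The neighbours of \<open>{u, v}\<close> in the line graph are the other edges at
  \<open>u\<close> and the other edges at \<open>v\<close>. These two families are disjoint since
  there are no parallel edges. Adding 2 on the left avoids truncated subtraction.\<close>

lemma vdegree_line_graph:
  assumes G: "simple_graph G" and e: "{u, v} \<in> edges G"
  shows "vdegree (line_graph G) {u, v} + 2 = vdegree G u + vdegree G v"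
proof -
  let ?e = "{u, v}"
  let ?A = "\<lambda>x. {f \<in> edges G. x \<in> f}"
  have fin: "finite (?A x)" for x
    using simple_graph_finite_edges[OF G] by simp
  have "card ?e = 2"
    using G e by (auto simp: simple_graph_def)
  then have "u \<noteq> v"
    by auto
  have eA: "?e \<in> ?A u" "?e \<in> ?A v"
    using e by auto
  \<comment> \<open>An edge of the line graph at \<open>?e\<close> is determined by its other end
    \<open>f\<close>, so counting these edges amounts to counting such \<open>f\<close>.\<close>
  have "{x \<in> edges (line_graph G). ?e \<in> x} = (\<lambda>f. {?e, f}) ` ((?A u - {?e}) \<union> (?A v - {?e}))"
  proof
    show "{x \<in> edges (line_graph G). ?e \<in> x} \<subseteq> (\<lambda>f. {?e, f}) ` ((?A u - {?e}) \<union> (?A v - {?e}))"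
    proof
      fix x assume "x \<in> {x \<in> edges (line_graph G). ?e \<in> x}"
      then obtain f g where x: "x = {f, g}" and fg: "f \<in> edges G" "g \<in> edges G" "f \<noteq> g" "f \<inter> g \<noteq> {}"
          and "?e = f \<or> ?e = g"
        unfolding line_graph_def by (simp, blast)
      then obtain h where "x = {?e, h}" "h \<in> edges G" "h \<noteq> ?e" "h \<inter> ?e \<noteq> {}"
      proof (elim disjE)
        assume "?e = f"
        show ?thesis
          by (rule that[of g]) (use fg in \<open>auto simp: x \<open>?e = f\<close>\<close>)
      next
        assume "?e = g"
        show ?thesis
          by (rule that[of f]) (use fg in \<open>auto simp: x \<open>?e = g\<close>\<close>)
      qed
      then show "x \<in> (\<lambda>f. {?e, f}) ` ((?A u - {?e}) \<union> (?A v - {?e}))"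
        by (intro image_eqI[where x = h]) auto
    qed
    show "(\<lambda>f. {?e, f}) ` ((?A u - {?e}) \<union> (?A v - {?e})) \<subseteq> {x \<in> edges (line_graph G). ?e \<in> x}"
    proof
      fix x assume "x \<in> (\<lambda>f. {?e, f}) ` ((?A u - {?e}) \<union> (?A v - {?e}))"
      then obtain h where "x = {?e, h}" "h \<in> edges G" "?e \<noteq> h" "?e \<inter> h \<noteq> {}"
        by auto
      then show "x \<in> {x \<in> edges (line_graph G). ?e \<in> x}"
        using e unfolding line_graph_def by (simp, blast)
    qed
  qed
  moreover have "inj_on (\<lambda>f. {?e, f}) ((?A u - {?e}) \<union> (?A v - {?e}))"
    by (auto simp: inj_on_def doubleton_eq_iff)
  ultimately have "vdegree (line_graph G) ?e = card ((?A u - {?e}) \<union> (?A v - {?e}))"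
    by (simp add: vdegree_def card_image)
  also have "\<dots> = card (?A u - {?e}) + card (?A v - {?e})"
  proof (rule card_Un_disjoint)
    \<comment> \<open>An edge containing both \<open>u\<close> and \<open>v\<close> has no further
      element and hence is \<open>?e\<close> itself.\<close>
    show "(?A u - {?e}) \<inter> (?A v - {?e}) = {}"
    proof (intro equals0I)
      fix f assume f: "f \<in> (?A u - {?e}) \<inter> (?A v - {?e})"
      then obtain w where "f = {u, w}"
        using simple_graph_edgeE[OF G] by (metis (no_types, lifting) DiffD1 IntD1 mem_Collect_eq)
      with f \<open>u \<noteq> v\<close> show False
        by auto
    qed
  qed (use fin in auto)
  also have "\<dots> = (card (?A u) - 1) + (card (?A v) - 1)"
    using eA by (simp only: card_Diff_singleton)
  finally have "vdegree (line_graph G) ?e = (card (?A u) - 1) + (card (?A v) - 1)" .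
  \<comment> \<open>Both cardinalities are positive, so neither subtraction of 1 is
    truncated.\<close>
  moreover have "0 < card (?A u)" "0 < card (?A v)"
    using eA fin card_gt_0_iff by blast+
  ultimately show ?thesis
    unfolding vdegree_def[of G] by linarith
qed

section \<open>Connectedness\<close>

text \<open>Induction along a path from \<open>a\<close>: no edge leaves \<open>A\<close>, so
  everything reachable from \<open>a\<close> stays in \<open>A\<close>. This is how connectedness
  determines the whole vertex set in the arguments that follow.\<close>

lemma connected_graph_closed_set:
  assumes "connected_graph G" "a \<in> A" "A \<subseteq> verts G"
    and closed: "\<And>e. e \<in> edges G \<Longrightarrow> e \<inter> A \<noteq> {} \<Longrightarrow> e \<subseteq> A"
  shows "verts G = A"
proof
  show "verts G \<subseteq> A"
  proof
    fix v assume "v \<in> verts G"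
    then have "(a, v) \<in> {(x, y). {x, y} \<in> edges G}\<^sup>*"
      using assms by (auto simp: connected_graph_def)
    then show "v \<in> A"
    proof induction
      case (step y z)
      then show ?case
        using closed[of "{y, z}"] by auto
    qed (rule \<open>a \<in> A\<close>)
  qed
qed fact

text \<open>If \<open>v\<close> were isolated, \<open>{v}\<close> would be closed under edges and
  thus be the whole vertex set, leaving no room for a two-element edge.\<close>

lemma connected_graph_vdegree_pos:
  assumes G: "simple_graph G" "connected_graph G" "edges G \<noteq> {}" and v: "v \<in> verts G"
  shows "0 < vdegree G v"
proof (rule ccontr)
  assume "\<not> 0 < vdegree G v"
  then have none: "{e \<in> edges G. v \<in> e} = {}"
    using simple_graph_finite_edges[OF G(1)] by (simp add: vdegree_def)
  have V: "verts G = {v}"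
    by (rule connected_graph_closed_set[OF G(2), of v]) (use v none in auto)
  obtain e where "e \<in> edges G"
    using G(3) by auto
  then have "e \<subseteq> {v}" "card e = 2"
    using G(1) V by (auto simp: simple_graph_def)
  then show False
    using card_mono[of "{v}" e] by simp
qed

lemma vdegree_eq_1_edge_unique:
  assumes "vdegree G v = 1" "e \<in> edges G" "v \<in> e" "f \<in> edges G" "v \<in> f"
  shows "f = e"
proof -
  obtain g where g: "{e \<in> edges G. v \<in> e} = {g}"
    using assms(1) unfolding vdegree_def by (meson card_1_singletonE)
  have "e \<in> {e \<in> edges G. v \<in> e}" "f \<in> {e \<in> edges G. v \<in> e}"
    using assms by simp_all
  then show ?thesis
    unfolding g by simp
qed

text \<open>No other edge meets \<open>{u, v}\<close>, so this set is closed and exhausts the graph.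
  The contrapositive is what excludes isolated vertices in the line graph.\<close>

lemma graph_iso_complete_graph_2:
  assumes G: "simple_graph G" "connected_graph G" and e: "{u, v} \<in> edges G"
    and d: "vdegree G u = 1" "vdegree G v = 1"
  shows "graph_iso G (complete_graph 2)"
proof -
  have "card {u, v} = 2" and sub: "{u, v} \<subseteq> verts G"
    using G e by (auto simp: simple_graph_def)
  then have uv: "u \<noteq> v"
    by auto
  have uniq: "f = {u, v}" if "f \<in> edges G" "f \<inter> {u, v} \<noteq> {}" for f
    using that vdegree_eq_1_edge_unique[OF d(1) e] vdegree_eq_1_edge_unique[OF d(2) e] by auto
  have V: "verts G = {u, v}"
    by (rule connected_graph_closed_set[OF G(2), of u]) (use sub uniq in auto)
  have ne: "f \<noteq> {}" "f \<subseteq> {u, v}" if "f \<in> edges G" for f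
    using G(1) that V by (auto simp: simple_graph_def)
  have E: "edges G = {{u, v}}"
  proof
    show "edges G \<subseteq> {{u, v}}"
      using uniq ne by blast
  qed (use e in simp)
  let ?f = "\<lambda>x. if x = u then 0 else 1 :: nat"
  have K: "edges (complete_graph 2) = {{0, 1}}" "verts (complete_graph 2) = {0, 1}"
    by (auto simp: complete_graph_def less_2_cases_iff insert_commute)
  have "bij_betw ?f (verts G) (verts (complete_graph 2))"
    using uv by (auto simp: V K bij_betw_def inj_on_def)
  moreover have "\<forall>x\<in>verts G. \<forall>y\<in>verts G. {x, y} \<in> edges G \<longleftrightarrow> {?f x, ?f y} \<in> edges (complete_graph 2)"
    using uv by (auto simp: V E K doubleton_eq_iff)
  ultimately show ?thesis
    unfolding graph_iso_def by blast
qed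

section \<open>The star on three vertices\<close>

lemma star_graph_3: "edges (star_graph 3) = {{0, 1}, {0, 2}}" "verts (star_graph 3) = {0, 1, 2}"
proof -
  have "0 < i \<and> i < 3 \<longleftrightarrow> i = 1 \<or> i = 2" for i :: nat
    by linarith
  then show "edges (star_graph 3) = {{0, 1}, {0, 2}}"
    unfolding star_graph_def by simp blast
  show "verts (star_graph 3) = {0, 1, 2}"
    by (auto simp: star_graph_def)
qed

lemma graph_iso_star_graph_3I:
  assumes "verts G = {a, b, c}" "edges G = {{a, b}, {a, c}}" "a \<noteq> b" "a \<noteq> c" "b \<noteq> c"
  shows "graph_iso G (star_graph 3)"
proof -
  let ?f = "\<lambda>x. if x = a then 0 else if x = b then 1 else 2 :: nat"
  have "bij_betw ?f (verts G) (verts (star_graph 3))"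
    using assms by (auto simp: star_graph_3 bij_betw_def inj_on_def)
  moreover have "\<forall>x\<in>verts G. \<forall>y\<in>verts G. {x, y} \<in> edges G \<longleftrightarrow> {?f x, ?f y} \<in> edges (star_graph 3)"
    using assms by (auto simp: star_graph_3 doubleton_eq_iff)
  ultimately show ?thesis
    unfolding graph_iso_def by blast
qed

text \<open>The vertices \<open>a\<close>, \<open>b\<close>, \<open>c\<close> are the preimages of
  0, 1, 2, with \<open>a\<close> as the centre. An isomorphism only controls sets
  \<open>{x, y}\<close> of vertices; simplicity of \<open>G\<close> ensures that every edge has this
  form, so that the edge set is determined.\<close>

lemma graph_iso_star_graph_3E:
  assumes G: "simple_graph G" and iso: "graph_iso G (star_graph 3)"
  obtains a b c where "verts G = {a, b, c}" "edges G = {{a, b}, {a, c}}" "a \<noteq> b" "a \<noteq> c" "b \<noteq> c"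
proof -
  obtain f where "bij_betw f (verts G) (verts (star_graph 3))"
    and "\<forall>x\<in>verts G. \<forall>y\<in>verts G. {x, y} \<in> edges G \<longleftrightarrow> {f x, f y} \<in> edges (star_graph 3)"
    using iso unfolding graph_iso_def by (elim exE conjE) (rule that)
  then have im: "f ` verts G = {0, 1, 2}" and inj: "inj_on f (verts G)"
    and f: "\<And>x y. x \<in> verts G \<Longrightarrow> y \<in> verts G \<Longrightarrow>
      {x, y} \<in> edges G \<longleftrightarrow> {f x, f y} \<in> {{0, 1}, {0, 2}}"
    unfolding star_graph_3 bij_betw_def by simp_all
  have "0 \<in> f ` verts G" "1 \<in> f ` verts G" "2 \<in> f ` verts G"
    by (simp_all add: im)
  then obtain a b c where abc: "a \<in> verts G" "b \<in> verts G" "c \<in> verts G" "f a = 0" "f b = 1" "f c = 2"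
    by fastforce
  have ne: "a \<noteq> b" "a \<noteq> c" "b \<noteq> c"
    using abc by auto
  have V: "verts G = {a, b, c}"
  proof
    show "verts G \<subseteq> {a, b, c}"
    proof
      fix x assume x: "x \<in> verts G"
      then have "f x \<in> {f a, f b, f c}"
        unfolding abc im[symmetric] by (rule imageI)
      then show "x \<in> {a, b, c}"
        by (simp add: inj_on_eq_iff[OF inj x] abc(1-3))
    qed
  qed (use abc in auto)
  have "edges G = {{a, b}, {a, c}}"
  proof
    show "edges G \<subseteq> {{a, b}, {a, c}}"
    proof
      fix e assume e: "e \<in> edges G"
      then have "card e = 2" "e \<subseteq> verts G"
        using G by (auto simp: simple_graph_def)
      then obtain x y where xy: "e = {x, y}" "x \<in> verts G" "y \<in> verts G" "x \<noteq> y"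
        by (metis card_2_iff insert_subset)
      then have "{f x, f y} \<in> {{0, 1}, {0, 2}}"
        using f e by simp
      then show "e \<in> {{a, b}, {a, c}}"
        using xy abc by (auto simp: V doubleton_eq_iff)
    qed
    show "{{a, b}, {a, c}} \<subseteq> edges G"
      using f abc by auto
  qed
  with V ne that show ?thesis
    by blast
qed

text \<open>Positive degrees with sum 3 are 2 and 1. A vertex \<open>a\<close> of degree 2 then has
  two neighbours of degree 1, and these three vertices form a closed set.\<close>

lemma graph_iso_star_graph_3_if_degree_sum_3:
  assumes G: "simple_graph G" "connected_graph G" "edges G \<noteq> {}"
    and d: "\<And>u v. {u, v} \<in> edges G \<Longrightarrow> vdegree G u + vdegree G v = 3"
  shows "graph_iso G (star_graph 3)"
proof -
  note pos = connected_graph_vdegree_pos[OF G]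
  obtain e where e: "e \<in> edges G"
    using G(3) by auto
  then obtain x y where xy: "e = {x, y}" "x \<noteq> y" "x \<in> verts G" "y \<in> verts G"
    using G(1) unfolding simple_graph_def by (metis card_2_iff insert_subset)
  have "vdegree G x + vdegree G y = 3"
    using d e xy by simp
  then have "vdegree G x = 2 \<and> vdegree G y = 1 \<or> vdegree G y = 2 \<and> vdegree G x = 1"
    using pos[of x] pos[of y] xy by linarith
  \<comment> \<open>Either endpoint may be the one of degree 2; from here on it is called
    \<open>a\<close>.\<close>
  then obtain a b where ab: "{a, b} \<in> edges G" "a \<noteq> b" "a \<in> verts G" "b \<in> verts G"
      and da: "vdegree G a = 2" and db: "vdegree G b = 1"
    using xy e by (metis insert_commute)
  have "card {f \<in> edges G. a \<in> f} = 2"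
    using da by (simp add: vdegree_def)
  then obtain p q where "{f \<in> edges G. a \<in> f} = {p, q}" "p \<noteq> q"
    by (meson card_2_iff)
  then obtain f where A: "{f \<in> edges G. a \<in> f} = {{a, b}, f}" and f_ne: "f \<noteq> {a, b}"
    using ab(1) by (metis (mono_tags, lifting) doubleton_eq_iff insertE insertI1 mem_Collect_eq singletonD)
  then have f: "f \<in> edges G" "a \<in> f"
    by auto
  then obtain c where c: "f = {a, c}" "a \<noteq> c" "c \<in> verts G"
    using simple_graph_edgeE[OF G(1)] by metis
  have "b \<noteq> c"
    using f_ne c by auto
  \<comment> \<open>The second edge at \<open>a\<close> also has degree sum 3, which leaves 1 for
    \<open>c\<close>.\<close>
  have dc: "vdegree G c = 1"
    using d[of a c] f c da by simp
  have cases: "g = {a, b} \<or> g = {a, c}" if g: "g \<in> edges G" "g \<inter> {a, b, c} \<noteq> {}" for g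
  proof -
    consider "a \<in> g" | "b \<in> g" | "c \<in> g"
      using g by auto
    then show ?thesis
    proof cases
      case 1
      then show ?thesis using A c g by blast
    next
      case 2
      then show ?thesis using vdegree_eq_1_edge_unique[OF db ab(1)] g by auto
    next
      case 3
      then show ?thesis using vdegree_eq_1_edge_unique[OF dc f(1)] c g by auto
    qed
  qed
  have V: "verts G = {a, b, c}"
  proof (rule connected_graph_closed_set[OF G(2), of a])
    fix g assume "g \<in> edges G" "g \<inter> {a, b, c} \<noteq> {}"
    from cases[OF this] show "g \<subseteq> {a, b, c}"
      by auto
  qed (use ab c in auto)
  have "edges G = {{a, b}, {a, c}}"
  proof
    show "edges G \<subseteq> {{a, b}, {a, c}}"
    proof
      fix g assume g: "g \<in> edges G"
      then have "card g = 2" "g \<subseteq> {a, b, c}"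
        using G(1) V by (auto simp: simple_graph_def)
      then have "g \<noteq> {}" "g \<subseteq> {a, b, c}"
        by auto
      then have "g \<inter> {a, b, c} \<noteq> {}"
        by blast
      with cases[OF g] show "g \<in> {{a, b}, {a, c}}"
        by blast
    qed
  qed (use ab f c in auto)
  then show ?thesis
    using V ab(2) c(2) \<open>b \<noteq> c\<close> by (intro graph_iso_star_graph_3I)
qed

section \<open>Regularity expressed through edges\<close>

text \<open>Every vertex lies on an edge because all degrees are positive, so a condition on
  endpoints reaches all vertices. Conversely, since \<open>k\<close> is attained, it must be the
  common degree of a regular graph.\<close>

lemma edges_degree_const_iff_regular:
  assumes G: "simple_graph G" "connected_graph G" "edges G \<noteq> {}"
    and k: "\<exists>v\<in>verts G. vdegree G v = k"
  shows "(\<forall>u v. {u, v} \<in> edges G \<longrightarrow> vdegree G u = k \<and> vdegree G v = k) \<longleftrightarrow> regular_graph G"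
proof
  assume all: "\<forall>u v. {u, v} \<in> edges G \<longrightarrow> vdegree G u = k \<and> vdegree G v = k"
  have "vdegree G v = k" if "v \<in> verts G" for v
  proof -
    have "{e \<in> edges G. v \<in> e} \<noteq> {}"
      using connected_graph_vdegree_pos[OF G that] unfolding vdegree_def by (metis card.empty less_irrefl)
    then obtain e where "e \<in> edges G" "v \<in> e"
      by auto
    then show ?thesis
      using simple_graph_edgeE[OF G(1)] all by metis
  qed
  then show "regular_graph G"
    by (auto simp: regular_graph_def)
next
  assume "regular_graph G"
  then have "\<forall>v\<in>verts G. vdegree G v = k"
    using k by (auto simp: regular_graph_def)
  then show "\<forall>u v. {u, v} \<in> edges G \<longrightarrow> vdegree G u = k \<and> vdegree G v = k"
    using G(1) by (auto simp: simple_graph_def)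
qed

theorem theorem4p2:
  fixes G :: "'a ugraph"
  assumes "simple_graph G"
    and "connected_graph G"
    and "edges G \<noteq> {}"
    and "\<not> graph_iso G (complete_graph 2)"
  shows "max (4 * (real (min_degree G) - 1)\<^sup>2) 1 * ID (line_graph G) \<le> SDD (line_graph G)
    \<and> SDD (line_graph G) \<le> 4 * (real (max_degree G) - 1)\<^sup>2 * ID (line_graph G)
    \<and> (max (4 * (real (min_degree G) - 1)\<^sup>2) 1 * ID (line_graph G) = SDD (line_graph G)
         \<longleftrightarrow> regular_graph G \<or> graph_iso G (star_graph 3))
    \<and> (SDD (line_graph G) = 4 * (real (max_degree G) - 1)\<^sup>2 * ID (line_graph G)
         \<longleftrightarrow> regular_graph G)"
proof -
  note G = assms(1-3)
  let ?L = "line_graph G" and ?d = "vdegree G"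
  define \<delta> \<Delta> where "\<delta> = min_degree G" and "\<Delta> = max_degree G"
  have fin: "finite (verts G)" and ne: "verts G \<noteq> {}"
    using G by (auto simp: simple_graph_def connected_graph_def)
  have bounds: "\<delta> \<le> ?d v" "?d v \<le> \<Delta>" if "v \<in> verts G" for v
    using fin that by (auto simp: \<delta>_def \<Delta>_def min_degree_def max_degree_def)
  have attained: "\<exists>v\<in>verts G. ?d v = \<delta>" "\<exists>v\<in>verts G. ?d v = \<Delta>"
    using Min_in[of "?d ` verts G"] Max_in[of "?d ` verts G"] fin ne
    unfolding \<delta>_def \<Delta>_def min_degree_def max_degree_def by (metis finite_imageI imageE image_is_empty)+
  then have "1 \<le> \<delta>"
    using connected_graph_vdegree_pos[OF G] by force
  have edge_verts: "u \<in> verts G" "v \<in> verts G" if "{u, v} \<in> edges G" for u v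
    using G(1) that by (auto simp: simple_graph_def)
  have edgeE: "\<exists>u v. e = {u, v}" if "e \<in> edges G" for e
    using G(1) that unfolding simple_graph_def by (meson card_2_iff)
  have dL: "vdegree ?L {u, v} + 2 = ?d u + ?d v" if "{u, v} \<in> edges G" for u v
    using G(1) that by (rule vdegree_line_graph)
  have L: "simple_graph ?L" and VL: "verts ?L = edges G"
    using G(1) by (auto simp: simple_graph_line_graph) (simp_all add: line_graph_def)
  \<comment> \<open>Two positive degrees with sum below 3 are both 1, which would make the graph
    \<open>K_2\<close>. Hence every degree in the line graph is at least 1.\<close>
  have ge3: "3 \<le> ?d u + ?d v" if e: "{u, v} \<in> edges G" for u v
  proof -
    have "?d u \<noteq> 1 \<or> ?d v \<noteq> 1"
      using graph_iso_complete_graph_2[OF G(1,2) e] assms(4) by blast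
    moreover have "0 < ?d u" "0 < ?d v"
      using connected_graph_vdegree_pos[OF G] edge_verts[OF e] by auto
    ultimately show ?thesis
      by linarith
  qed
  have L_all: "(\<forall>e\<in>verts ?L. real (vdegree ?L e) = x) \<longleftrightarrow>
      (\<forall>u v. {u, v} \<in> edges G \<longrightarrow> real (?d u) + real (?d v) = x + 2)" for x
  proof -
    have "(\<forall>e\<in>verts ?L. real (vdegree ?L e) = x) \<longleftrightarrow>
        (\<forall>u v. {u, v} \<in> edges G \<longrightarrow> real (vdegree ?L {u, v}) = x)"
      unfolding VL using edgeE by blast
    also have "\<dots> \<longleftrightarrow> (\<forall>u v. {u, v} \<in> edges G \<longrightarrow> real (?d u) + real (?d v) = x + 2)"
    proof -
      have "real (vdegree ?L {u, v}) = x \<longleftrightarrow> real (?d u) + real (?d v) = x + 2"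
        if "{u, v} \<in> edges G" for u v
        using dL[OF that] by linarith
      then show ?thesis
        by meson
    qed
    finally show ?thesis .
  qed

  \<comment> \<open>Lower bound for the degrees in the line graph: the first term comes from the
    minimum degree, the second from \<open>ge3\<close>.\<close>
  define m where "m = max (2 * (real \<delta> - 1)) 1"
  \<comment> \<open>For \<open>\<delta> = 1\<close> the first term is 0 and both maxima are 1;
    otherwise \<open>\<delta> - 1\<close> is at least 1 and the first term wins on both
    sides.\<close>
  have m_sq: "m\<^sup>2 = max (4 * (real (min_degree G) - 1)\<^sup>2) 1"
  proof (cases "\<delta> = 1")
    case True
    then show ?thesis
      by (simp add: m_def \<delta>_def[symmetric])
  next
    case False
    then have "1 \<le> real \<delta> - 1"
      using \<open>1 \<le> \<delta>\<close> by linarith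
    then have m: "m = 2 * (real \<delta> - 1)" and "1 \<le> (real \<delta> - 1)\<^sup>2"
      by (auto simp: m_def one_le_power)
    moreover have "m\<^sup>2 = 4 * (real \<delta> - 1)\<^sup>2"
      unfolding m power_mult_distrib by simp
    ultimately show ?thesis
      by (simp add: \<delta>_def[symmetric])
  qed
  have L_ge: "m \<le> real (vdegree ?L e)" "0 < vdegree ?L e" "real (vdegree ?L e) \<le> 2 * (real \<Delta> - 1)"
    if eL: "e \<in> verts ?L" for e
  proof -
    obtain u v where e: "e = {u, v}" "{u, v} \<in> edges G"
      using eL edgeE[of e] unfolding VL by auto
    have bnd: "real \<delta> \<le> real (?d u)" "real \<delta> \<le> real (?d v)"
        "real (?d u) \<le> real \<Delta>" "real (?d v) \<le> real \<Delta>"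
      using bounds[OF edge_verts(1)[OF e(2)]] bounds[OF edge_verts(2)[OF e(2)]] by simp_all
    have deg: "real (vdegree ?L e) + 2 = real (?d u) + real (?d v)"
      using dL[OF e(2)] unfolding e(1) by linarith
    show "real (vdegree ?L e) \<le> 2 * (real \<Delta> - 1)"
      using bnd deg by (simp add: algebra_simps)
    show pos: "0 < vdegree ?L e"
      using dL[OF e(2)] ge3[OF e(2)] unfolding e(1) by linarith
    have "2 * (real \<delta> - 1) \<le> real (vdegree ?L e)"
      using bnd deg by (simp add: algebra_simps)
    moreover have "1 \<le> real (vdegree ?L e)"
      using pos by simp
    ultimately show "m \<le> real (vdegree ?L e)"
      by (simp add: m_def)
  qed
  have "0 < m"
    by (simp add: m_def)
  \<comment> \<open>Some edge exists, and its positive degree in the line graph is at most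
    \<open>2 * (\<Delta> - 1)\<close>. So this constant is positive, as \<open>SDD_le_ID\<close>
    demands.\<close>
  obtain e where "e \<in> verts ?L"
    using G(3) VL by auto
  then have "0 < 2 * (real \<Delta> - 1)"
    using L_ge[of e] by linarith
  note lower = SDD_ge_ID[OF L \<open>0 < m\<close> L_ge(1), unfolded m_sq]
  note upper = SDD_le_ID[OF L L_ge(2) \<open>0 < 2 * (real \<Delta> - 1)\<close> L_ge(3)]
  have M_sq: "(2 * (real \<Delta> - 1))\<^sup>2 = 4 * (real (max_degree G) - 1)\<^sup>2"
    unfolding \<Delta>_def power_mult_distrib by simp

  \<comment> \<open>Both endpoint degrees are at most \<open>\<Delta>\<close>, so their sum is
    \<open>2 * \<Delta>\<close> only if both equal \<open>\<Delta>\<close>.\<close>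
  have eq_upper: "(\<forall>e\<in>verts ?L. real (vdegree ?L e) = 2 * (real \<Delta> - 1)) \<longleftrightarrow> regular_graph G"
  proof -
    have "real (?d u) + real (?d v) = 2 * (real \<Delta> - 1) + 2 \<longleftrightarrow> ?d u = \<Delta> \<and> ?d v = \<Delta>"
      if "{u, v} \<in> edges G" for u v
      using bounds(2)[of u] bounds(2)[of v] edge_verts[OF that] by auto
    then show ?thesis
      unfolding L_all edges_degree_const_iff_regular[OF G attained(2), symmetric] by blast
  qed
  have eq_lower: "(\<forall>e\<in>verts ?L. real (vdegree ?L e) = m) \<longleftrightarrow>
      regular_graph G \<or> graph_iso G (star_graph 3)"
  \<comment> \<open>The case split decides which term of \<open>m\<close> is the larger. For
    \<open>\<delta> = 1\<close> the condition becomes degree sum 3 on every edge, which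
    characterizes the star; regularity would give degree sum 2, against \<open>ge3\<close>.\<close>
  proof (cases "\<delta> = 1")
    case True
    have "\<not> regular_graph G"
    proof
      assume "regular_graph G"
      then have deg1: "?d v = 1" if "v \<in> verts G" for v
        using attained(1) that True by (auto simp: regular_graph_def)
      obtain u v where "{u, v} \<in> edges G"
        using G(3) edgeE by fast
      then show False
        using deg1[of u] deg1[of v] edge_verts[of u v] ge3[of u v] by simp
    qed
    moreover have "(\<forall>u v. {u, v} \<in> edges G \<longrightarrow> ?d u + ?d v = 3) \<longleftrightarrow> graph_iso G (star_graph 3)"
    proof
      assume "graph_iso G (star_graph 3)"
      then obtain a b c where E: "edges G = {{a, b}, {a, c}}" and abc: "a \<noteq> b" "a \<noteq> c" "b \<noteq> c"
        using graph_iso_star_graph_3E[OF G(1)] by metis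
      have "{e \<in> edges G. a \<in> e} = {{a, b}, {a, c}}" "{e \<in> edges G. b \<in> e} = {{a, b}}"
          "{e \<in> edges G. c \<in> e} = {{a, c}}"
        using abc by (auto simp: E)
      then have "?d a = 2" "?d b = 1" "?d c = 1"
        using abc by (auto simp: vdegree_def doubleton_eq_iff)
      then show "\<forall>u v. {u, v} \<in> edges G \<longrightarrow> ?d u + ?d v = 3"
        by (auto simp: E doubleton_eq_iff)
    qed (use graph_iso_star_graph_3_if_degree_sum_3[OF G] in blast)
    moreover have "real (?d u) + real (?d v) = m + 2 \<longleftrightarrow> ?d u + ?d v = 3" for u v
      using True by (auto simp: m_def)
    ultimately show ?thesis
      unfolding L_all by simp
  next
    case False
    then have m: "m = 2 * (real \<delta> - 1)"
      using \<open>1 \<le> \<delta>\<close> by (simp add: m_def)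
    \<comment> \<open>Now \<open>\<delta>\<close> is at least 2, whereas a leaf of the star has
      degree 1.\<close>
    have "\<not> graph_iso G (star_graph 3)"
    proof
      assume "graph_iso G (star_graph 3)"
      then obtain a b c where V: "verts G = {a, b, c}" and E: "edges G = {{a, b}, {a, c}}"
          and abc: "a \<noteq> b" "a \<noteq> c" "b \<noteq> c"
        using graph_iso_star_graph_3E[OF G(1)] by metis
      have "{e \<in> edges G. b \<in> e} = {{a, b}}"
        using abc by (auto simp: E)
      then have "?d b = 1"
        by (simp add: vdegree_def)
      then show False
        using bounds(1)[of b] V False \<open>1 \<le> \<delta>\<close> by simp
    qed
    \<comment> \<open>Both degrees are at least \<open>\<delta>\<close> and their sum is
      \<open>2 * \<delta>\<close>, so each equals \<open>\<delta>\<close>.\<close>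
    moreover have "real (?d u) + real (?d v) = m + 2 \<longleftrightarrow> ?d u = \<delta> \<and> ?d v = \<delta>"
      if "{u, v} \<in> edges G" for u v
      using bounds(1)[of u] bounds(1)[of v] edge_verts[OF that] by (auto simp: m)
    ultimately show ?thesis
      unfolding L_all edges_degree_const_iff_regular[OF G attained(1), symmetric] by blast
  qed
  show ?thesis
    using lower upper unfolding M_sq eq_lower eq_upper by blast
qed

end
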